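(* Let $0\le\alpha\le\beta$ and let $T:\mathbb{R}^d\to\mathbb{R}^d$ be a measurable statistic with (measurable) inverse $T^{-1}$. Let $\widehat\theta_n$ be the $\min\mathfrak{R}_{\alpha}$-estimator in the model $\mathcal{P}=(P_\theta:\theta\in\Theta)$ based on observations $X_1,\dots,X_n$, and let $\tilde\theta_n$ be the $\min\mathfrak{R}_{\alpha}$-estimator in the transformed model $\tilde{\mathcal{P}}=(\tilde P_\theta=P_\theta T^{-1}:\theta\in\Theta)$ (with densities $\tilde p_\theta$ with respect to the dominating measure $\tilde\lambda$) based on the observations $TX_1,\dots,TX_n$. If the Jacobian $\mathcal{J}_T$ of the transformation is a nonzero constant on the transformed observation space, then $\tilde\theta_n$ coincides with $\widehat\theta_n$. Thus the $\min\mathfrak{R}_{\alpha}$-estimators are equivariant under linear statistics $Tx=ax+b$ (with $a$ invertible, and densities of both models taken with respect to Lebesgue measure), i.e. for such $T$ one has $\tilde\theta_n=\widehat\theta_n$.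
   Context: $\mathcal{P}=\{P_\theta:\theta\in\Theta\}$ is a parametric family of probability measures on $(\mathbb{R}^d,\mathcal{B}(\mathbb{R}^d))$ with Euclidean parameter space $\Theta$, all with the same support, and $p_\theta=\mathrm{d}P_\theta/\mathrm{d}\lambda$ is the density with respect to Lebesgue measure $\lambda$. $\mathcal{P}^{+}=\mathcal{P}\cup\mathcal{P}_0$, where $\mathcal{P}_0$ is a further family of probability measures. It is assumed that for some $\beta>0$, $p^\beta,q^\beta,\ln p\in\mathbb{L}_1(Q)$ for all $P\in\mathcal{P}$, $Q\in\mathcal{P}^{+}$ ($p,q$ being the densities of $P,Q$). $\min\mathfrak{R}_{\alpha}$-estimator: in a model with densities $p_\theta$ with respect to a dominating measure $\lambda$, based on observations $X_1,\dots,X_n$, $$\widehat\theta_n=\arg\sup_{\theta\in\Theta}\ C_\alpha(\theta)^{-1}\frac1n\sum_{i=1}^np_\theta^\alpha(X_i)\quad\text{if }0<\alpha\le\beta,\qquad \widehat\theta_n=\arg\sup_{\theta\in\Theta}\frac1n\sum_{i=1}^n\ln p_\theta(X_i)\quad\text{if }\alpha=0,$$ where $C_\alpha(\theta)=\left(\int p_\theta^{1+\alpha}\,\mathrm{d}\lambda\right)^{\alpha/(1+\alpha)}$. In the transformed model the same definition is used with $\tilde p_\theta,\tilde\lambda$ and $TX_i$ in place of $p_\theta,\lambda$ and $X_i$. The maximizer need not be unique; "coincide" means that the two criterion functions have the same maximizers over $\Theta$. Transformed model: $\tilde\lambda$ is a $\sigma$-finite measure on $\mathbb{R}^d$ dominating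 $\lambda T^{-1}$ (the image of $\lambda$ under $T$), and the densities $\tilde p_\theta=\mathrm{d}\tilde P_\theta/\mathrm{d}\tilde\lambda$ are given by $$\tilde p_\theta(y)=p_\theta(T^{-1}y)\,\mathcal{J}_T(y),\qquad \mathcal{J}_T(y)=\frac{\mathrm{d}\,\lambda T^{-1}}{\mathrm{d}\tilde\lambda}(y),$$ where $\mathcal{J}_T$ is the generalized Jacobian of $T$. When $\tilde\lambda$ is Lebesgue measure and $H=T^{-1}$ is differentiable, $\mathcal{J}_T(y)=\left|\frac{\mathrm{d}}{\mathrm{d}y}H(y)\right|$ (absolute value of the Jacobian determinant). *)

theory Defs
  imports "HOL-Probability.Probability"
begin

definition has_pdf :: "'a measure \<Rightarrow> 'a measure \<Rightarrow> ('a \<Rightarrow> real) \<Rightarrow> bool" where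
  "has_pdf Q M f \<longleftrightarrow>
     f \<in> borel_measurable M \<and> (\<forall>x. 0 \<le> f x) \<and> Q = density M (\<lambda>x. ennreal (f x))"

definition msupport :: "'a::topological_space measure \<Rightarrow> 'a set" where
  "msupport Q = {x. \<forall>U. open U \<and> x \<in> U \<longrightarrow> 0 < emeasure Q U}"

text \<open>
  The family \<open>P \<theta>\<close> (\<open>\<theta> \<in> \<Theta>\<close>) has Lebesgue densities \<open>p \<theta>\<close>; the extended family is
  \<open>P ` \<Theta> \<union> P0\<close>.  Since \<open>ln 0 = 0\<close> in HOL, membership of \<open>ln p\<close> in \<open>L\<^sub>1(Q)\<close> is integrability
  together with \<open>p > 0\<close> almost everywhere with respect to \<open>Q\<close>.
\<close>

definition admissible_model ::
  "real \<Rightarrow> 'k set \<Rightarrow> ('k \<Rightarrow> 'a::euclidean_space measure) \<Rightarrow> ('k \<Rightarrow> 'a \<Rightarrow> real)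
     \<Rightarrow> 'a measure set \<Rightarrow> bool" where
  "admissible_model \<beta> \<Theta> P p P0 \<longleftrightarrow>
     (\<forall>\<theta>\<in>\<Theta>. prob_space (P \<theta>) \<and> has_pdf (P \<theta>) lborel (p \<theta>)) \<and>
     (\<forall>\<theta>\<in>\<Theta>. \<forall>\<theta>'\<in>\<Theta>. msupport (P \<theta>) = msupport (P \<theta>')) \<and>
     (\<forall>Q\<in>P0. prob_space Q) \<and>
     (\<forall>Q\<in>P ` \<Theta> \<union> P0. \<exists>q. has_pdf Q lborel q \<and> integrable Q (\<lambda>x. q x powr \<beta>)) \<and>
     (\<forall>\<theta>\<in>\<Theta>. \<forall>Q\<in>P ` \<Theta> \<union> P0.
        integrable Q (\<lambda>x. p \<theta> x powr \<beta>) \<and>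
        (AE x in Q. 0 < p \<theta> x) \<and> integrable Q (\<lambda>x. ln (p \<theta> x)))"

definition xln :: "real \<Rightarrow> ereal" where
  "xln x = (if 0 < x then ereal (ln x) else - \<infinity>)"

definition C_norm :: "real \<Rightarrow> 'a measure \<Rightarrow> ('k \<Rightarrow> 'a \<Rightarrow> real) \<Rightarrow> 'k \<Rightarrow> real" where
  "C_norm \<alpha> M p \<theta> = (\<integral>x. p \<theta> x powr (1 + \<alpha>) \<partial>M) powr (\<alpha> / (1 + \<alpha>))"

text \<open>
  Values are extended reals because the log-likelihood is \<open>-\<infinity>\<close> when an observation falls
  outside \<open>{p \<theta> > 0}\<close>.
\<close>

definition minR_criterion ::
  "real \<Rightarrow> 'a measure \<Rightarrow> ('k \<Rightarrow> 'a \<Rightarrow> real) \<Rightarrow> nat \<Rightarrow> (nat \<Rightarrow> 'a) \<Rightarrow> 'k \<Rightarrow> ereal" where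
  "minR_criterion \<alpha> M p n X \<theta> =
     (if \<alpha> = 0 then ereal (1 / real n) * (\<Sum>i=1..n. xln (p \<theta> (X i)))
      else ereal (inverse (C_norm \<alpha> M p \<theta>) * (1 / real n) * (\<Sum>i=1..n. p \<theta> (X i) powr \<alpha>)))"

text \<open>The maximizer need not exist or be unique, so the estimator is the set of all maximizers.\<close>

definition minR_estimators ::
  "real \<Rightarrow> 'k set \<Rightarrow> 'a measure \<Rightarrow> ('k \<Rightarrow> 'a \<Rightarrow> real) \<Rightarrow> nat \<Rightarrow> (nat \<Rightarrow> 'a) \<Rightarrow> 'k set" where
  "minR_estimators \<alpha> \<Theta> M p n X =
     {\<theta>. is_arg_max (minR_criterion \<alpha> M p n X) (\<lambda>\<theta>. \<theta> \<in> \<Theta>) \<theta>}"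

text \<open>
  \<open>J\<close> is a version of the Radon-Nikodym derivative of \<open>\<lambda>T\<^sup>-\<^sup>1\<close> with respect to \<open>M\<close>.
  A predicate is used instead of \<open>RN_deriv\<close>, which picks an arbitrary version and hence has no
  meaningful pointwise values.
\<close>

definition generalized_jacobian ::
  "'a::euclidean_space measure \<Rightarrow> ('a \<Rightarrow> 'a) \<Rightarrow> ('a \<Rightarrow> real) \<Rightarrow> bool" where
  "generalized_jacobian M T J \<longleftrightarrow> has_pdf (distr lborel borel T) M J"

definition jacobian_abs_det :: "(real^'d \<Rightarrow> real^'d) \<Rightarrow> real^'d \<Rightarrow> real" where
  "jacobian_abs_det H y = \<bar>det (matrix (frechet_derivative H (at y)))\<bar>"

definition transformed_density ::
  "('a \<Rightarrow> 'a) \<Rightarrow> ('a \<Rightarrow> real) \<Rightarrow> ('k \<Rightarrow> 'a \<Rightarrow> real) \<Rightarrow> 'k \<Rightarrow> 'a \<Rightarrow> real" where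
  "transformed_density T J p \<theta> y = p \<theta> (inv T y) * J y"

lemma has_pdf_transformed_density:
  fixes T :: "'a::euclidean_space \<Rightarrow> 'a"
  assumes "bij T" and T [measurable]: "T \<in> borel_measurable borel"
    and Ti [measurable]: "inv T \<in> borel_measurable borel"
    and M [measurable_cong]: "sets M = sets borel"
    and J: "generalized_jacobian M T J"
    and p: "has_pdf (P \<theta>) lborel (p \<theta>)"
  shows "has_pdf (distr (P \<theta>) borel T) M (transformed_density T J p \<theta>)"
proof -
  have [measurable]: "p \<theta> \<in> borel_measurable borel" "J \<in> borel_measurable M"
    and nonneg: "\<And>x. 0 \<le> p \<theta> x" "\<And>y. 0 \<le> J y"
    and P: "P \<theta> = density lborel (\<lambda>x. ennreal (p \<theta> x))"
    and D: "distr lborel borel T = density M (\<lambda>x. ennreal (J x))"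
    using J p by (auto simp: generalized_jacobian_def has_pdf_def)
  have inv: "\<And>x. inv T (T x) = x"
    using \<open>bij T\<close> by (simp add: bij_is_inj)
  have "distr (P \<theta>) borel T = density (distr lborel borel T) (\<lambda>y. ennreal (p \<theta> (inv T y)))"
    unfolding P by (subst density_distr) (simp_all add: inv)
  also have "\<dots> = density M (\<lambda>y. ennreal (transformed_density T J p \<theta> y))"
    unfolding D by (subst density_density_eq)
      (auto simp: transformed_density_def ennreal_mult nonneg mult.commute intro!: density_cong)
  finally show ?thesis
    by (auto simp: has_pdf_def transformed_density_def[abs_def] nonneg)
qed

end

theory Submission
  imports Defs
begin

text \<open>
  If \<open>J\<close> is a constant \<open>c\<close>, the transformed density at \<open>T x\<close> is \<open>c * p \<theta> x\<close>, so in the criterion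
  the transformed observations only contribute a factor \<open>c powr \<alpha>\<close> (for \<open>\<alpha> > 0\<close>), respectively a
  summand \<open>ln c\<close> (for \<open>\<alpha> = 0\<close>), that does not depend on \<open>\<theta>\<close>.  The normalizer
  \<open>C_norm\<close> behaves the same way: change of variables turns the integral of
  \<open>(c * (p \<theta> \<circ> inv T)) powr (1 + \<alpha>)\<close> into a constant times the integral of \<open>p \<theta> powr (1 + \<alpha>)\<close>.
  Hence the two criteria differ by an increasing transformation that is common to all \<open>\<theta>\<close>, and they
  have the same maximizers.  This is lemma \<open>minR_estimators_rescaled\<close>.

  The constant \<open>c\<close> in the density and the factor \<open>s\<close> between the image of Lebesgue measure and the
  dominating measure enter independently: any two positive numbers give an increasing
  transformation.  For \<open>T x = A x + b\<close> it is therefore enough to know that the Jacobian determinant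
  of the inverse map is a nonzero constant and that the image of Lebesgue measure under \<open>T\<close> is
  \<^emph>\<open>some\<close> positive multiple of Lebesgue measure.
  The latter follows from uniqueness of translation-invariant measures
  (\<open>translation_invariant_eq_scaled_lborel\<close>), without computing the volume of a linear image.
\<close>

section \<open>Criteria that differ by an increasing transformation\<close>

lemma is_arg_max_cong_order:
  assumes "\<And>x y. P x \<Longrightarrow> P y \<Longrightarrow> (f x < f y) = (g x < g y)"
  shows "is_arg_max f P x = is_arg_max g P x"
  using assms by (auto simp: is_arg_max_def)

lemma xln_mult_left:
  assumes "c > 0"
  shows "xln (c * a) = xln a + ereal (ln c)"
  using assms by (auto simp: xln_def ln_mult zero_less_mult_iff)

text \<open>
  Since Bochner integrals of non-integrable functions are \<open>0\<close>, this change of variables holds for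
  every measurable \<open>g\<close>, and the normalizers can be compared for each \<open>\<alpha>\<close> whether or not the integrals
  in them converge.
\<close>

lemma integral_of_rescaled_density:
  fixes f :: "'a \<Rightarrow> real" and g :: "'b \<Rightarrow> real"
  assumes T [measurable]: "T \<in> measurable L N" and M: "sets M = sets N"
    and D: "distr L N T = density M (\<lambda>_. ennreal s)" and "s > 0"
    and g [measurable]: "g \<in> borel_measurable N"
    and gT: "\<And>x. g (T x) = k * f x"
  shows "(\<integral>y. g y \<partial>M) = k / s * (\<integral>x. f x \<partial>L)"
proof -
  have [measurable]: "g \<in> borel_measurable M"
    using g M by (simp cong: measurable_cong_sets)
  have "s * (\<integral>y. g y \<partial>M) = (\<integral>y. g y \<partial>density M (\<lambda>_. ennreal s))"
    using \<open>s > 0\<close> by (subst integral_density) auto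
  also have "\<dots> = (\<integral>x. g (T x) \<partial>L)"
    unfolding D[symmetric] by (rule integral_distr) measurable
  also have "\<dots> = k * (\<integral>x. f x \<partial>L)"
    by (simp add: gT)
  finally show ?thesis
    using \<open>s > 0\<close> by (simp add: field_simps)
qed

text \<open>
  Replacing the density by \<open>q\<close> multiplies the power sum by \<open>c powr \<alpha>\<close> and the normalizer by the
  number \<open>k\<close> of the proof.  Both are positive and independent of \<open>\<theta>\<close>.  Keeping \<open>c\<close> and \<open>s\<close> separate is
  what lets the affine case avoid the volume formula.
\<close>

lemma minR_estimators_rescaled:
  fixes T :: "'a::euclidean_space \<Rightarrow> 'a"
  assumes T [measurable]: "T \<in> borel_measurable borel" and M: "sets M = sets borel"
    and D: "distr lborel borel T = density M (\<lambda>_. ennreal s)"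
    and "s > 0" and "c > 0"
    and q: "\<And>\<theta>. \<theta> \<in> \<Theta> \<Longrightarrow> q \<theta> \<in> borel_measurable borel"
    and qT: "\<And>\<theta> x. \<theta> \<in> \<Theta> \<Longrightarrow> q \<theta> (T x) = c * p \<theta> x"
    and "n \<ge> 1"
  shows "minR_estimators \<alpha> \<Theta> M q n (\<lambda>i. T (X i)) = minR_estimators \<alpha> \<Theta> lborel p n X"
proof (cases "\<alpha> = 0")
  case True
  have shift: "(\<Sum>i=1..n. xln (q \<theta> (T (X i)))) =
      (\<Sum>i=1..n. xln (p \<theta> (X i))) + ereal (real n * ln c)" if "\<theta> \<in> \<Theta>" for \<theta>
    using that \<open>c > 0\<close> by (simp add: qT xln_mult_left sum.distrib)
  \<comment> \<open>Adding a finite number respects the strict order also between \<open>-\<infinity>\<close> and finite values.\<close>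
  have mono: "(ereal (1 / real n) * (a + ereal r) < ereal (1 / real n) * (b + ereal r)) =
      (ereal (1 / real n) * a < ereal (1 / real n) * b)" for a b :: ereal and r
    using \<open>n \<ge> 1\<close> by (cases a; cases b) (auto simp: divide_strict_right_mono field_simps)
  show ?thesis
    unfolding minR_estimators_def
    by (intro Collect_cong is_arg_max_cong_order)
       (simp only: minR_criterion_def True refl if_True shift mono)
next
  case False
  define k where "k = (c powr (1 + \<alpha>) / s) powr (\<alpha> / (1 + \<alpha>))"
  have "k > 0"
    using \<open>c > 0\<close> \<open>s > 0\<close> by (simp add: k_def)
  have C: "C_norm \<alpha> M q \<theta> = k * C_norm \<alpha> lborel p \<theta>" if "\<theta> \<in> \<Theta>" for \<theta>
  proof -
    have [measurable]: "q \<theta> \<in> borel_measurable borel"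
      by (rule q[OF that])
    have "(\<integral>y. q \<theta> y powr (1 + \<alpha>) \<partial>M) =
        c powr (1 + \<alpha>) / s * (\<integral>x. p \<theta> x powr (1 + \<alpha>) \<partial>lborel)"
      by (rule integral_of_rescaled_density[of T lborel borel M s])
         (use that M D \<open>s > 0\<close> \<open>c > 0\<close> in \<open>auto simp: qT powr_mult\<close>)
    then show ?thesis
      using \<open>c > 0\<close> \<open>s > 0\<close> unfolding C_norm_def k_def
      by (simp only: powr_mult)
  qed
  have scale: "minR_criterion \<alpha> M q n (\<lambda>i. T (X i)) \<theta> =
      ereal (c powr \<alpha> / k) * minR_criterion \<alpha> lborel p n X \<theta>" if "\<theta> \<in> \<Theta>" for \<theta>
    using that False \<open>c > 0\<close>
    by (simp add: minR_criterion_def C qT powr_mult sum_distrib_left[symmetric] divide_inverse)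
  have finite: "\<bar>minR_criterion \<alpha> lborel p n X \<theta>\<bar> \<noteq> \<infinity>" for \<theta>
    using False by (simp add: minR_criterion_def)
  have "c powr \<alpha> / k > 0"
    using \<open>c > 0\<close> \<open>k > 0\<close> by simp
  then have mono: "(ereal (c powr \<alpha> / k) * a < ereal (c powr \<alpha> / k) * b) = (a < b)"
    if "\<bar>a\<bar> \<noteq> \<infinity>" "\<bar>b\<bar> \<noteq> \<infinity>" for a b :: ereal
    using that by (cases a; cases b)
      (simp_all only: times_ereal.simps less_ereal.simps mult_less_cancel_left_pos, auto)
  show ?thesis
    unfolding minR_estimators_def
    by (intro Collect_cong is_arg_max_cong_order) (simp add: scale mono finite)
qed

section \<open>Affine images of Lebesgue measure\<close>

text \<open>
  Let \<open>B\<close> be the unit box.  The integral of the indicator of \<open>{(x, y). x \<in> A \<and> x + y \<in> B}\<close> with respect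
  to \<open>\<mu> \<Otimes>\<^sub>M lborel\<close> is \<open>\<mu> A\<close> times the volume of \<open>B\<close> if \<open>y\<close> is integrated first.
  If \<open>x\<close> is integrated first, invariance of \<open>\<mu>\<close> allows \<open>x\<close> to be replaced by \<open>x - y\<close>, and
  Tonelli gives \<open>\<mu> B\<close> times the volume of \<open>A\<close>.
\<close>

lemma translation_invariant_eq_scaled_lborel:
  fixes \<mu> :: "'a::euclidean_space measure"
  assumes sets_\<mu> [measurable_cong]: "sets \<mu> = sets borel" and "sigma_finite_measure \<mu>"
    and invar: "\<And>v. distr \<mu> borel (\<lambda>x. x + v) = \<mu>"
  shows "\<mu> = density lborel (\<lambda>_. emeasure \<mu> (box 0 One))"
proof (rule measure_eqI)
  show "sets \<mu> = sets (density lborel (\<lambda>_. emeasure \<mu> (box 0 One)))"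
    by (simp add: sets_\<mu>)
next
  fix A assume "A \<in> sets \<mu>"
  then have A [measurable]: "A \<in> sets borel"
    by (simp add: sets_\<mu>)
  define B :: "'a set" where "B = box 0 One"
  have B [measurable]: "B \<in> sets borel"
    by (simp add: B_def)
  have "emeasure lborel B = 1"
    by (simp add: B_def emeasure_lborel_box_eq)
  interpret sigma_finite_measure \<mu> by fact
  interpret pair_sigma_finite \<mu> lborel
    by unfold_locales
  have lborel_shift: "(\<integral>\<^sup>+y. indicator B (x + y) \<partial>lborel) = emeasure lborel B" for x
  proof -
    have "(\<integral>\<^sup>+y. indicator B (x + y) \<partial>lborel) = (\<integral>\<^sup>+y. indicator B y \<partial>distr lborel borel ((+) x))"
      by (subst nn_integral_distr) auto
    also have "\<dots> = emeasure lborel B"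
      by (simp add: lborel_distr_plus)
    finally show ?thesis .
  qed
  have lborel_reflect: "(\<integral>\<^sup>+y. indicator A (x - y) \<partial>lborel) = emeasure lborel A" for x
  proof -
    have "(\<integral>\<^sup>+y. indicator A (x - y) \<partial>lborel) =
        (\<integral>\<^sup>+y. indicator A y \<partial>distr lborel borel (\<lambda>y. x + (- 1) *\<^sub>R y))"
      by (subst nn_integral_distr) auto
    also have "\<dots> = emeasure (distr lborel borel (\<lambda>y. x + (- 1) *\<^sub>R y)) A"
      by simp
    also have "\<dots> = emeasure lborel A"
      by (subst (2) lborel_affine[of "- 1" x]) (simp_all add: density_1)
    finally show ?thesis .
  qed
  have "emeasure \<mu> A * emeasure lborel B = (\<integral>\<^sup>+x. indicator A x * emeasure lborel B \<partial>\<mu>)"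
    by (subst nn_integral_multc) auto
  also have "\<dots> = (\<integral>\<^sup>+x. \<integral>\<^sup>+y. indicator A x * indicator B (x + y) \<partial>lborel \<partial>\<mu>)"
    by (subst nn_integral_cmult) (auto simp: lborel_shift)
  also have "\<dots> = (\<integral>\<^sup>+y. \<integral>\<^sup>+x. indicator A x * indicator B (x + y) \<partial>\<mu> \<partial>lborel)"
    by (rule Fubini'[symmetric]) measurable
  also have "\<dots> = (\<integral>\<^sup>+y. \<integral>\<^sup>+x. indicator A (x - y) * indicator B x \<partial>\<mu> \<partial>lborel)"
  proof (rule nn_integral_cong)
    fix y :: 'a
    have "(\<integral>\<^sup>+x. indicator A (x - y) * indicator B x \<partial>\<mu>) =
        (\<integral>\<^sup>+x. indicator A (x - y) * indicator B x \<partial>distr \<mu> borel (\<lambda>x. x + y))"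
      by (simp add: invar)
    also have "\<dots> = (\<integral>\<^sup>+x. indicator A x * indicator B (x + y) \<partial>\<mu>)"
      by (subst nn_integral_distr) auto
    finally show "(\<integral>\<^sup>+x. indicator A x * indicator B (x + y) \<partial>\<mu>) =
        (\<integral>\<^sup>+x. indicator A (x - y) * indicator B x \<partial>\<mu>)" ..
  qed
  also have "\<dots> = (\<integral>\<^sup>+x. \<integral>\<^sup>+y. indicator A (x - y) * indicator B x \<partial>lborel \<partial>\<mu>)"
    by (rule Fubini') measurable
  also have "\<dots> = (\<integral>\<^sup>+x. emeasure lborel A * indicator B x \<partial>\<mu>)"
    by (subst nn_integral_multc) (auto simp: lborel_reflect)
  also have "\<dots> = emeasure lborel A * emeasure \<mu> B"
    by (subst nn_integral_cmult) auto
  finally have "emeasure \<mu> A = emeasure \<mu> B * emeasure lborel A"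
    by (simp add: \<open>emeasure lborel B = 1\<close> mult.commute)
  then show "emeasure \<mu> A = emeasure (density lborel (\<lambda>_. emeasure \<mu> (box 0 One))) A"
    by (simp add: B_def emeasure_density nn_integral_cmult_indicator)
qed

text \<open>
  The image measure is invariant because translating \<open>L x + b\<close> by \<open>v\<close> amounts to translating \<open>x\<close> by
  \<open>L' v\<close>.  It is finite on boxes because \<open>L'\<close> maps bounded sets to bounded sets, and the factor cannot
  vanish because the whole space has infinite measure.
\<close>

lemma distr_lborel_affine:
  fixes L L' :: "'a::euclidean_space \<Rightarrow> 'a" and b :: 'a
  assumes L: "linear L" and L': "linear L'" and LL': "\<And>x. L (L' x) = x" and L'L: "\<And>x. L' (L x) = x"
  obtains s where "s > 0" "distr lborel borel (\<lambda>x. L x + b) = density lborel (\<lambda>_. ennreal s)"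
proof -
  define \<mu> where "\<mu> = distr lborel borel (\<lambda>x. L x + b)"
  have [measurable]: "L \<in> borel_measurable borel" "L' \<in> borel_measurable borel"
    using L L' by (auto intro!: borel_measurable_continuous_onI linear_continuous_on
        simp: linear_conv_bounded_linear)
  have sets_\<mu> [measurable_cong]: "sets \<mu> = sets borel"
    by (simp add: \<mu>_def)
  have finite_box: "emeasure \<mu> (box u v) < \<infinity>" for u v
  proof -
    have "(\<lambda>x. L x + b) -` box u v = L' ` ((\<lambda>x. x - b) ` box u v)"
      by (force simp: L'L LL')
    moreover have "bounded ((\<lambda>x. x - b) ` box u v)"
      using bounded_translation_minus bounded_box by blast
    ultimately have "bounded ((\<lambda>x. L x + b) -` box u v)"
      using L' by (simp add: bounded_linear_image linear_conv_bounded_linear)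
    then have "emeasure lborel ((\<lambda>x. L x + b) -` box u v) < \<infinity>"
      by (rule emeasure_bounded_finite)
    then show ?thesis
      by (simp add: \<mu>_def emeasure_distr)
  qed
  have "sigma_finite_measure \<mu>"
  proof (rule sigma_finite_measure.intro)
    show "\<exists>A. countable A \<and> A \<subseteq> sets \<mu> \<and> \<Union>A = space \<mu> \<and> (\<forall>a\<in>A. emeasure \<mu> a \<noteq> \<infinity>)"
    proof (intro exI conjI ballI)
      let ?A = "range (\<lambda>n::nat. box (- (real n *\<^sub>R One)) (real n *\<^sub>R One) :: 'a set)"
      show "countable ?A" by simp
      show "?A \<subseteq> sets \<mu>" by (auto simp: sets_\<mu>)
      show "\<Union>?A = space \<mu>"
        using UN_box_eq_UNIV by (auto simp: \<mu>_def)
      show "emeasure \<mu> a \<noteq> \<infinity>" if "a \<in> ?A" for a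
        using that finite_box by (auto simp: less_top[symmetric])
    qed
  qed
  moreover have "distr \<mu> borel (\<lambda>x. x + v) = \<mu>" for v
  proof -
    have "distr \<mu> borel (\<lambda>x. x + v) = distr lborel borel (\<lambda>x. L (L' v + x) + b)"
      unfolding \<mu>_def by (subst distr_distr) (auto simp: o_def linear_add[OF L] LL' ac_simps)
    also have "\<dots> = distr (distr lborel borel ((+) (L' v))) borel (\<lambda>x. L x + b)"
      by (subst distr_distr) (auto simp: o_def)
    also have "\<dots> = \<mu>"
      by (simp add: lborel_distr_plus \<mu>_def)
    finally show ?thesis .
  qed
  ultimately have eq: "\<mu> = density lborel (\<lambda>_. emeasure \<mu> (box 0 One))"
    by (intro translation_invariant_eq_scaled_lborel sets_\<mu>)
  define s where "s = measure \<mu> (box 0 One)"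
  have s: "ennreal s = emeasure \<mu> (box 0 One)"
    unfolding s_def using finite_box by (simp add: measure_def less_top)
  have "emeasure \<mu> UNIV = \<infinity>"
    by (simp add: \<mu>_def emeasure_distr)
  have "s \<noteq> 0"
  proof
    assume "s = 0"
    then have "emeasure \<mu> UNIV = 0"
      by (subst eq) (simp add: s[symmetric] emeasure_density)
    with \<open>emeasure \<mu> UNIV = \<infinity>\<close> show False
      by simp
  qed
  then have "s > 0"
    by (simp add: s_def less_le)
  then show ?thesis
    using that eq s by (simp add: \<mu>_def)
qed

section \<open>Equivariance\<close>

lemma matrix_inv_mult:
  fixes A :: "real^'d^'d"
  assumes "invertible A"
  shows "A ** matrix_inv A = mat 1" "matrix_inv A ** A = mat 1"
  using someI_ex[OF assms[unfolded invertible_def]] by (simp_all add: matrix_inv_def)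

lemma inv_affine:
  fixes A :: "real^'d^'d"
  assumes "invertible A"
  shows "inv (\<lambda>x. A *v x + b) = (\<lambda>y. matrix_inv A *v (y - b))"
  using assms
  by (intro inv_equality) (auto simp: matrix_vector_mul_assoc matrix_inv_mult)

lemma jacobian_abs_det_inv_affine:
  fixes A :: "real^'d^'d"
  assumes "invertible A"
  shows "jacobian_abs_det (inv (\<lambda>x. A *v x + b)) y = \<bar>det (matrix_inv A)\<bar>"
    and "\<bar>det (matrix_inv A)\<bar> > 0"
proof -
  have "((\<lambda>y. matrix_inv A *v (y - b)) has_derivative (\<lambda>h. matrix_inv A *v h)) (at y)"
    by (rule bounded_linear.has_derivative[OF matrix_vector_mul_bounded_linear])
       (auto intro!: derivative_eq_intros)
  then have "frechet_derivative (inv (\<lambda>x. A *v x + b)) (at y) = (\<lambda>h. matrix_inv A *v h)"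
    unfolding inv_affine[OF assms] by (rule frechet_derivative_at[symmetric])
  then show "jacobian_abs_det (inv (\<lambda>x. A *v x + b)) y = \<bar>det (matrix_inv A)\<bar>"
    by (simp add: jacobian_abs_det_def)
  have "det A * det (matrix_inv A) = 1"
    using assms by (metis det_I det_mul matrix_inv_mult(1))
  then show "\<bar>det (matrix_inv A)\<bar> > 0"
    by auto
qed

theorem theorem3:
  fixes \<Theta> :: "'k::euclidean_space set"
    and P :: "'k \<Rightarrow> (real^'d) measure"
    and p :: "'k \<Rightarrow> real^'d \<Rightarrow> real"
    and P0 :: "(real^'d) measure set"
    and \<alpha> \<beta> :: real
  assumes "\<beta> > 0" and "0 \<le> \<alpha>" and "\<alpha> \<le> \<beta>"
    and "admissible_model \<beta> \<Theta> P p P0"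
  shows
    "(\<forall>(M :: (real^'d) measure) (T :: real^'d \<Rightarrow> real^'d) J c.
        T \<in> borel_measurable borel \<and> bij T \<and> inv T \<in> borel_measurable borel \<and>
        sets M = sets borel \<and> sigma_finite_measure M \<and>
        absolutely_continuous M (distr lborel borel T) \<and>
        generalized_jacobian M T J \<and>
        c \<noteq> 0 \<and> (\<forall>y\<in>range T. J y = c) \<longrightarrow>
        (\<forall>n\<ge>1. \<forall>X :: nat \<Rightarrow> real^'d.
           minR_estimators \<alpha> \<Theta> M (transformed_density T J p) n (\<lambda>i. T (X i))
             = minR_estimators \<alpha> \<Theta> lborel p n X)) \<and>
     (\<forall>(A :: real^'d^'d) (b :: real^'d) (T :: real^'d \<Rightarrow> real^'d).
        invertible A \<and> T = (\<lambda>x. A *v x + b) \<longrightarrow>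
        (\<forall>n\<ge>1. \<forall>X :: nat \<Rightarrow> real^'d.
           minR_estimators \<alpha> \<Theta> lborel
               (transformed_density T (jacobian_abs_det (inv T)) p) n (\<lambda>i. T (X i))
             = minR_estimators \<alpha> \<Theta> lborel p n X))"
proof (intro conjI allI impI; (elim conjE)?)
  have p [measurable]: "p \<theta> \<in> borel_measurable borel" if "\<theta> \<in> \<Theta>" for \<theta>
    using assms(4) that by (auto simp: admissible_model_def has_pdf_def)
  {
    fix M :: "(real^'d) measure" and T :: "real^'d \<Rightarrow> real^'d" and J c n and X :: "nat \<Rightarrow> real^'d"
    assume T [measurable]: "T \<in> borel_measurable borel" and "bij T"
      and Ti [measurable]: "inv T \<in> borel_measurable borel"
      and M: "sets M = sets borel" and J: "generalized_jacobian M T J"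
      and "c \<noteq> 0" and c: "\<forall>y\<in>range T. J y = c" and "1 \<le> (n::nat)"
    have J_eq: "J = (\<lambda>_. c)"
      using c \<open>bij T\<close> by (auto simp: bij_is_surj)
    \<comment> \<open>A density is nonnegative, so a nonzero constant value of it is positive.\<close>
    then have "c > 0" and D: "distr lborel borel T = density M (\<lambda>_. ennreal c)"
      using J \<open>c \<noteq> 0\<close> by (auto simp: generalized_jacobian_def has_pdf_def less_le)
    show "minR_estimators \<alpha> \<Theta> M (transformed_density T J p) n (\<lambda>i. T (X i))
        = minR_estimators \<alpha> \<Theta> lborel p n X"
    proof (rule minR_estimators_rescaled[OF T M D \<open>c > 0\<close> \<open>c > 0\<close>])
      show "transformed_density T J p \<theta> \<in> borel_measurable borel" if "\<theta> \<in> \<Theta>" for \<theta>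
        using p[OF that] unfolding transformed_density_def[abs_def] J_eq by measurable
      show "transformed_density T J p \<theta> (T x) = c * p \<theta> x" for \<theta> x
        using \<open>bij T\<close> by (simp add: transformed_density_def J_eq bij_is_inj)
    qed (use \<open>1 \<le> n\<close> in auto)
  next
    fix A :: "real^'d^'d" and b :: "real^'d" and T :: "real^'d \<Rightarrow> real^'d" and n
      and X :: "nat \<Rightarrow> real^'d"
    assume A: "invertible A" and T_eq: "T = (\<lambda>x. A *v x + b)" and "1 \<le> (n::nat)"
    let ?c = "\<bar>det (matrix_inv A)\<bar>"
    have J_eq: "jacobian_abs_det (inv T) = (\<lambda>_. ?c)" and "?c > 0"
      using jacobian_abs_det_inv_affine[OF A] by (auto simp: T_eq)
    have inv: "inv T = (\<lambda>y. matrix_inv A *v (y - b))"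
      unfolding T_eq by (rule inv_affine[OF A])
    obtain s where "s > 0" and D: "distr lborel borel T = density lborel (\<lambda>_. ennreal s)"
      using distr_lborel_affine[of "(*v) A" "(*v) (matrix_inv A)" b] A
      by (auto simp: T_eq matrix_vector_mul_assoc matrix_inv_mult)
    have T: "T \<in> borel_measurable borel"
      unfolding T_eq by (auto intro!: borel_measurable_continuous_onI continuous_intros)
    have Ti [measurable]: "inv T \<in> borel_measurable borel"
      unfolding inv by (auto intro!: borel_measurable_continuous_onI continuous_intros
          bounded_linear.continuous_on[OF matrix_vector_mul_bounded_linear])
    show "minR_estimators \<alpha> \<Theta> lborel (transformed_density T (jacobian_abs_det (inv T)) p) n (\<lambda>i. T (X i))
        = minR_estimators \<alpha> \<Theta> lborel p n X"
    proof (rule minR_estimators_rescaled[OF T _ D \<open>s > 0\<close> \<open>?c > 0\<close>])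
      show "transformed_density T (jacobian_abs_det (inv T)) p \<theta> \<in> borel_measurable borel"
        if "\<theta> \<in> \<Theta>" for \<theta>
        using p[OF that] unfolding transformed_density_def[abs_def] J_eq by measurable
      show "transformed_density T (jacobian_abs_det (inv T)) p \<theta> (T x) = ?c * p \<theta> x" for \<theta> x
      proof -
        have "inv T (T x) = x"
          unfolding inv using A by (simp add: T_eq matrix_vector_mul_assoc matrix_inv_mult)
        then show ?thesis
          by (simp add: transformed_density_def J_eq)
      qed
    qed (use \<open>1 \<le> n\<close> in auto)
  }
qed

end
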